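(* Let $\mathcal{X}$ be a complex Banach space, let $\mathcal{B}(\mathcal{X})$ be the algebra of all bounded linear operators on $\mathcal{X}$, let $W\in\mathcal{B}(\mathcal{X})$ be such that $\overline{W(\mathcal{X})}\neq\mathcal{X}$, and let $\phi:\mathcal{B}(\mathcal{X})\to\mathcal{B}(\mathcal{X})$ be an additive mapping. Then the following are equivalent: (i) $\phi$ is Lie centralizable at $W$, i.e. for all $A,B\in\mathcal{B}(\mathcal{X})$ with $AB=W$ one has $\phi([A,B])=[\phi(A),B]=[A,\phi(B)]$; (ii) there exist $\lambda\in\mathbb{C}$ and an additive mapping $\mu:\mathcal{B}(\mathcal{X})\to\mathbb{C}I$ such that $\mu([A,B])=0$ for all $A,B\in\mathcal{B}(\mathcal{X})$ with $AB=W$, and $\phi(A)=\lambda A+\mu(A)$ for all $A\in\mathcal{B}(\mathcal{X})$.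
   Context: $[A,B]=AB-BA$ denotes the Lie product, $I$ is the identity operator on $\mathcal{X}$, $\mathbb{C}I=\{\xi I:\xi\in\mathbb{C}\}$, and $\overline{W(\mathcal{X})}$ is the norm closure of the range of $W$. Additive mappings are not assumed to be linear or continuous. *)

theory Defs
  imports "HOL-Analysis.Bounded_Linear_Function"
begin

section \<open>Complex Banach spaces\<close>

class scaleC =
  fixes scaleC :: "complex \<Rightarrow> 'a \<Rightarrow> 'a" (infixr "*\<^sub>C" 75)

text \<open>As with the real classes of the library, the real scalar multiplication is part of the
  structure; it is required to be the restriction of the complex one.\<close>

class complex_vector = real_vector + scaleC +
  assumes scaleC_add_right: "c *\<^sub>C (x + y) = c *\<^sub>C x + c *\<^sub>C y"
    and scaleC_add_left: "(c + d) *\<^sub>C x = c *\<^sub>C x + d *\<^sub>C x"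
    and scaleC_scaleC: "c *\<^sub>C d *\<^sub>C x = (c * d) *\<^sub>C x"
    and scaleC_one: "1 *\<^sub>C x = x"
    and scaleR_scaleC: "r *\<^sub>R x = complex_of_real r *\<^sub>C x"

class complex_banach = complex_vector + banach +
  assumes norm_scaleC: "norm (c *\<^sub>C x) = cmod c * norm x"

lemma bounded_linear_scaleC: "bounded_linear (\<lambda>x::'a::complex_banach. c *\<^sub>C x)"
  by (rule bounded_linear_intro[where K = "cmod c"])
     (simp_all add: scaleC_add_right scaleR_scaleC scaleC_scaleC norm_scaleC mult.commute)


section \<open>The algebra of bounded linear operators\<close>

text \<open>The library type of bounded linear maps only knows real linearity; the bounded complex
  linear operators are those commuting with complex scalars.\<close>

typedef (overloaded) 'a bop =
  "{f :: 'a::complex_banach \<Rightarrow>\<^sub>L 'a. \<forall>c x. blinfun_apply f (c *\<^sub>C x) = c *\<^sub>C blinfun_apply f x}"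
  morphisms blinfun_of_bop Bop
  by (rule exI[of _ id_blinfun]) simp

setup_lifting type_definition_bop

lift_definition bop_apply :: "'a::complex_banach bop \<Rightarrow> 'a \<Rightarrow> 'a" is blinfun_apply .

lemma bop_eqI: "(\<And>x. bop_apply A x = bop_apply B x) \<Longrightarrow> A = B"
  by transfer (rule blinfun_eqI)

text \<open>The unit is given by the class \<open>monoid_mult\<close> and not by \<open>ring_1\<close>, since the latter
  would exclude the zero space.\<close>

instantiation bop :: (complex_banach) "{ring, monoid_mult, complex_vector}"
begin

lift_definition zero_bop :: "'a bop" is 0
  by (simp add: linear_0[OF bounded_linear.linear[OF bounded_linear_scaleC]])

lift_definition one_bop :: "'a bop" is id_blinfun by simp

lift_definition plus_bop :: "'a bop \<Rightarrow> 'a bop \<Rightarrow> 'a bop" is "(+)"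
  by (simp add: blinfun.add_left scaleC_add_right)

lift_definition uminus_bop :: "'a bop \<Rightarrow> 'a bop" is uminus
  by (simp add: blinfun.minus_left linear_neg[OF bounded_linear.linear[OF bounded_linear_scaleC]])

lift_definition minus_bop :: "'a bop \<Rightarrow> 'a bop \<Rightarrow> 'a bop" is "(-)"
  by (simp add: blinfun.diff_left linear_diff[OF bounded_linear.linear[OF bounded_linear_scaleC]])

lift_definition times_bop :: "'a bop \<Rightarrow> 'a bop \<Rightarrow> 'a bop" is "(o\<^sub>L)"
  by simp

lift_definition scaleR_bop :: "real \<Rightarrow> 'a bop \<Rightarrow> 'a bop" is "(*\<^sub>R)"
  by (simp add: blinfun.scaleR_left scaleR_scaleC scaleC_scaleC mult.commute)

lift_definition scaleC_bop :: "complex \<Rightarrow> 'a bop \<Rightarrow> 'a bop"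
  is "\<lambda>c f. Blinfun (\<lambda>x. c *\<^sub>C blinfun_apply f x)"
  by (simp add: bounded_linear_Blinfun_apply
      bounded_linear_compose[OF bounded_linear_scaleC blinfun.bounded_linear_right]
      scaleC_scaleC mult.commute)

lemma bop_apply_simps:
  "bop_apply (0 :: 'a bop) x = 0"
  "bop_apply (1 :: 'a bop) x = x"
  "bop_apply (A + B) x = bop_apply A x + bop_apply B x"
  "bop_apply (- A) x = - bop_apply A x"
  "bop_apply (A - B) x = bop_apply A x - bop_apply B x"
  "bop_apply (A * B) x = bop_apply A (bop_apply B x)"
  "bop_apply (r *\<^sub>R A) x = r *\<^sub>R bop_apply A x"
  "bop_apply (c *\<^sub>C A) x = c *\<^sub>C bop_apply A x"
  for A B :: "'a bop"
  by (transfer; simp add: blinfun.add_left blinfun.minus_left blinfun.diff_left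
      blinfun.scaleR_left bounded_linear_Blinfun_apply
      bounded_linear_compose[OF bounded_linear_scaleC blinfun.bounded_linear_right])+

lemma bop_apply_add: "bop_apply A (x + y) = bop_apply A x + bop_apply A y"
  by transfer (rule blinfun.add_right)

instance
  by intro_classes
     (rule bop_eqI, simp add: bop_apply_simps bop_apply_add algebra_simps
        scaleC_add_right scaleC_add_left scaleC_scaleC scaleC_one scaleR_scaleC)+

end


section \<open>Lie centralizable mappings\<close>

definition lie_product :: "'a::ring \<Rightarrow> 'a \<Rightarrow> 'a" where
  "lie_product A B = A * B - B * A"

definition lie_centralizable_at :: "('a::ring \<Rightarrow> 'a) \<Rightarrow> 'a \<Rightarrow> bool" where
  "lie_centralizable_at \<phi> W \<longleftrightarrow>
     (\<forall>A B. A * B = W \<longrightarrow>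
        \<phi> (lie_product A B) = lie_product (\<phi> A) B \<and>
        lie_product (\<phi> A) B = lie_product A (\<phi> B))"

definition scalar_ops :: "'a::complex_banach bop set" where
  "scalar_ops = {\<xi> *\<^sub>C 1 | \<xi>. True}"

end

theory Submission imports Defs begin

text \<open>The substance is the implication from Lie centralizability to the decomposition; the converse
  holds because scalars drop out of Lie products.

  Since \<open>W\<close> does not have dense range, the Hahn--Banach theorem gives a bounded functional \<open>f\<close>
  with \<open>f \<circ> W = 0\<close> and a vector \<open>x\<close> with \<open>f x = 1\<close>. The rank one idempotent \<open>Q = x \<otimes> f\<close> then
  satisfies \<open>Q * W = 0\<close>. Write
  \<open>P = 1 - Q\<close> and let \<open>R\<close> be the algebra of bounded operators. If \<open>A * B = W\<close> and \<open>A * D = 0\<close>, then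
  also \<open>A * (B + D) = W\<close>, and subtracting the two hypotheses shows
  \<open>\<phi> [A, D] = [\<phi> A, D] = [A, \<phi> D]\<close>. Thus \<open>W\<close> disappears and a condition on zero products remains,
  valid whenever the left factor \<open>A\<close> divides \<open>W\<close> on the left. This division is possible for
  sufficiently many \<open>A\<close>: for \<open>A \<in> PRP\<close> and a large scalar \<open>c\<close>, the operator \<open>A + c\<close> has a right
  inverse \<open>S\<close>, whence \<open>(A + cP) * (S * W) = P * W = W\<close>; the multiple \<open>cP\<close> divides \<open>W\<close> too and can
  be subtracted again by additivity.

  What remains is an additive computation in the Peirce decomposition of \<open>R\<close> with respect to
  \<open>Q\<close>, using only that \<open>QRQ\<close> consists of scalar multiples of \<open>Q\<close> and that \<open>QRV = 0\<close> or
  \<open>VRQ = 0\<close> forces \<open>V = 0\<close>. Zero products \<open>A * D\<close> with \<open>A \<in> PRP\<close> and \<open>D \<in> QR\<close> show that on \<open>QRP\<close>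
  the map \<open>\<phi>\<close> is right multiplication by an element which commutes with \<open>PRP\<close>, hence is a
  multiplication by a scalar \<open>l\<close>, and that \<open>\<psi> A = \<phi> A - l A\<close> is scalar for \<open>A \<in> PRP\<close>
  (\<open>lie_centralizer_on_corner\<close>).
  For \<open>N \<in> PRQ\<close> the idempotent \<open>Q + N\<close> also annihilates \<open>W\<close> from the left. The zero product of
  \<open>1 - Q - N\<close> and \<open>(Q + N) * G\<close> with \<open>G \<in> QRP\<close> yields
  \<open>\<psi> (N * G * N) = \<psi> (N * G) - \<psi> (G * N)\<close>. Its left side is quadratic in \<open>N\<close> and its right side is
  additive in \<open>N\<close>, so both vanish; as every element of \<open>PRQ\<close> has the form \<open>N * G * N\<close> and every
  element of \<open>QRQ\<close> the form \<open>G * N\<close>, the values of \<open>\<psi>\<close> on these two Peirce components are scalar as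
  well (\<open>lie_centralizer_eq_scaling_plus_scalar\<close>). If \<open>Q = 1\<close>, the space is one-dimensional and all
  operators are scalar.\<close>

section \<open>Sublinear functionals and the Hahn--Banach theorem\<close>

definition sublinear :: "('a::real_vector \<Rightarrow> real) \<Rightarrow> bool" where
  "sublinear p \<longleftrightarrow> (\<forall>x y. p (x + y) \<le> p x + p y) \<and> (\<forall>r x. 0 \<le> r \<longrightarrow> p (r *\<^sub>R x) = r * p x)"

lemma sublinearD:
  assumes "sublinear p"
  shows "p (x + y) \<le> p x + p y" "0 \<le> r \<Longrightarrow> p (r *\<^sub>R x) = r * p x"
    "p 0 = 0" "- p (- x) \<le> p x"
proof -
  show 1: "p (x + y) \<le> p x + p y" for x y using assms by (simp add: sublinear_def)
  show 2: "0 \<le> r \<Longrightarrow> p (r *\<^sub>R x) = r * p x" for r x using assms by (simp add: sublinear_def)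
  show 3: "p 0 = 0" using 2[of 0 0] by simp
  show "- p (- x) \<le> p x" using 1[of x "- x"] 3 by simp
qed

lemma sublinearI:
  assumes add: "\<And>x y. p (x + y) \<le> p x + p y" and zero: "p 0 = 0"
    and scale: "\<And>r x. 0 < r \<Longrightarrow> p (r *\<^sub>R x) \<le> r * p x"
  shows "sublinear p"
proof -
  have "p (r *\<^sub>R x) = r * p x" if "0 \<le> r" for r x
  proof (cases "r = 0")
    case False
    then have r: "0 < r" using that by simp
    then have "p x \<le> inverse r * p (r *\<^sub>R x)"
      using scale[of "inverse r" "r *\<^sub>R x"] by simp
    then have "r * p x \<le> p (r *\<^sub>R x)" using r by (simp add: field_simps)
    then show ?thesis using scale[OF r] by (intro antisym)
  qed (simp add: zero)
  with add show ?thesis by (simp add: sublinear_def)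
qed

text \<open>The largest sublinear functional \<open>q \<le> p\<close> with \<open>q (- z) \<le> - p z\<close>. It serves twice: a functional
  below it takes the prescribed value \<open>p z\<close> at \<open>z\<close>, and a minimal \<open>p\<close> must coincide with it for
  every \<open>z\<close>, which forces \<open>p\<close> to be additive.\<close>

definition sublinear_descent :: "('a::real_vector \<Rightarrow> real) \<Rightarrow> 'a \<Rightarrow> 'a \<Rightarrow> real" where
  "sublinear_descent p z x = (INF t\<in>{0..}. p (x + t *\<^sub>R z) - t * p z)"

text \<open>The infimum is finite because \<open>t * p z = p (t z) \<le> p (x + t z) + p (- x)\<close>; without this bound
  the infimum would be a default value.\<close>

lemma sublinear_descent_le:
  assumes p: "sublinear p" and t: "0 \<le> t"
  shows "sublinear_descent p z x \<le> p (x + t *\<^sub>R z) - t * p z"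
proof -
  have "- p (- x) \<le> p (x + s *\<^sub>R z) - s * p z" if "0 \<le> s" for s
    using sublinearD(1)[OF p, of "x + s *\<^sub>R z" "- x"] sublinearD(2)[OF p that, of z] by simp
  then have "bdd_below ((\<lambda>t. p (x + t *\<^sub>R z) - t * p z) ` {0..})"
    by (auto intro!: bdd_belowI2)
  then show ?thesis
    unfolding sublinear_descent_def using t by (intro cINF_lower) auto
qed

lemma sublinear_descent_ge:
  assumes "\<And>t. 0 \<le> t \<Longrightarrow> m \<le> p (x + t *\<^sub>R z) - t * p z"
  shows "m \<le> sublinear_descent p z x"
  unfolding sublinear_descent_def using assms by (intro cINF_greatest) auto

lemma sublinear_sublinear_descent:
  assumes p: "sublinear p"
  shows "sublinear (sublinear_descent p z)"
proof (rule sublinearI)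
  let ?q = "sublinear_descent p z"
  fix x y :: 'a
  have split: "?q (x + y) \<le> (p (x + s *\<^sub>R z) - s * p z) + (p (y + t *\<^sub>R z) - t * p z)"
    if "0 \<le> s" "0 \<le> t" for s t
    using sublinear_descent_le[OF p, of "s + t" z "x + y"] that
      sublinearD(1)[OF p, of "x + s *\<^sub>R z" "y + t *\<^sub>R z"]
    by (simp add: algebra_simps)
  have "?q (x + y) - (p (x + s *\<^sub>R z) - s * p z) \<le> ?q y" if "0 \<le> s" for s
    using split[OF that] by (intro sublinear_descent_ge) (simp add: algebra_simps)
  then have "?q (x + y) - ?q y \<le> p (x + s *\<^sub>R z) - s * p z" if "0 \<le> s" for s
    using that by (simp add: algebra_simps)
  then have "?q (x + y) - ?q y \<le> ?q x" by (rule sublinear_descent_ge)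
  then show "?q (x + y) \<le> ?q x + ?q y" by simp
next
  let ?q = "sublinear_descent p z"
  show "?q 0 = 0"
    using sublinear_descent_le[OF p, of 0 z 0]
    by (intro antisym sublinear_descent_ge) (simp_all add: sublinearD[OF p])
  fix r :: real and x :: 'a assume r: "0 < r"
  have "?q (r *\<^sub>R x) / r \<le> ?q x"
  proof (rule sublinear_descent_ge)
    fix t :: real assume "0 \<le> t"
    then show "?q (r *\<^sub>R x) / r \<le> p (x + t *\<^sub>R z) - t * p z"
      using sublinear_descent_le[OF p, of "r * t" z "r *\<^sub>R x"] r
        sublinearD(2)[OF p, of r "x + t *\<^sub>R z"]
      by (simp add: field_simps scaleR_add_right)
  qed
  then show "?q (r *\<^sub>R x) \<le> r * ?q x" using r by (simp add: field_simps)
qed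

text \<open>Zorn's lemma is applied to globally defined sublinear functionals instead of partially defined
  linear ones: the pointwise infimum of a chain is again sublinear, and it is finite because
  every \<open>q \<le> p\<close> satisfies \<open>- p (- x) \<le> q x\<close>.\<close>

lemma ex_minimal_sublinear:
  assumes p: "sublinear p"
  obtains q where "sublinear q" "q \<le> p" "\<And>q'. sublinear q' \<Longrightarrow> q' \<le> q \<Longrightarrow> q' = q"
proof -
  let ?A = "{q. sublinear q \<and> q \<le> p}"
  let ?R = "relation_of (\<lambda>a b. b \<le> a) ?A"
  have "\<exists>m\<in>?A. \<forall>a\<in>?A. a \<le> m \<longrightarrow> a = m"
  proof (rule predicate_Zorn)
    show "partial_order_on ?A ?R"
      by (auto simp: partial_order_on_def preorder_on_def refl_on_def trans_def antisym_def
          relation_of_def)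
    fix C assume C: "C \<in> Chains ?R"
    then have sub: "\<And>q. q \<in> C \<Longrightarrow> sublinear q" and le: "\<And>q. q \<in> C \<Longrightarrow> q \<le> p"
      and chain: "\<And>q q'. q \<in> C \<Longrightarrow> q' \<in> C \<Longrightarrow> q \<le> q' \<or> q' \<le> q"
      by (auto simp: Chains_def relation_of_def)
    show "\<exists>u\<in>?A. \<forall>a\<in>C. u \<le> a"
    proof (cases "C = {}")
      case True
      then show ?thesis using p by auto
    next
      case False
      then obtain q0 where q0: "q0 \<in> C" by auto
      define u where "u x = (INF q\<in>C. q x)" for x
      have low: "- p (- x) \<le> q x" if "q \<in> C" for q x
        using sublinearD(4)[OF sub[OF that], of x] le_funD[OF le[OF that], of "- x"] by linarith
      have u_le: "u x \<le> q x" if "q \<in> C" for q x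
        unfolding u_def using that low by (intro cINF_lower bdd_belowI2[where m = "- p (- x)"]) auto
      have u_ge: "m \<le> u x" if "\<And>q. q \<in> C \<Longrightarrow> m \<le> q x" for m x
        unfolding u_def using that False by (intro cINF_greatest) auto
      have add: "u (x + y) \<le> u x + u y" for x y
      proof -
        \<comment> \<open>Two functionals of a chain are comparable, so both sums can be bounded by the smaller one.\<close>
        have "u (x + y) \<le> q x + q' y" if "q \<in> C" "q' \<in> C" for q q'
          using chain[OF that] u_le[OF that(1), of "x + y"] u_le[OF that(2), of "x + y"]
            sublinearD(1)[OF sub[OF that(1)], of x y] sublinearD(1)[OF sub[OF that(2)], of x y]
          by (auto simp: le_fun_def) (smt (verit))+
        then have "u (x + y) - q x \<le> q' y" if "q \<in> C" "q' \<in> C" for q q'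
          using that by (simp add: diff_le_eq add.commute[of "q' y"])
        then have "u (x + y) - q x \<le> u y" if "q \<in> C" for q
          using that by (intro u_ge)
        then have "u (x + y) - u y \<le> q x" if "q \<in> C" for q
          using that by (simp add: diff_le_eq add.commute[of "q x"])
        then have "u (x + y) - u y \<le> u x" by (rule u_ge)
        then show ?thesis by simp
      qed
      have zero: "u 0 = 0"
      proof (rule antisym)
        show "u 0 \<le> 0" using u_le[OF q0, of 0] sublinearD(3)[OF sub[OF q0]] by simp
        show "0 \<le> u 0" by (rule u_ge) (simp add: sublinearD(3)[OF sub])
      qed
      have scale: "u (r *\<^sub>R x) \<le> r * u x" if r: "0 < r" for r x
      proof -
        have "u (r *\<^sub>R x) / r \<le> u x"
        proof (rule u_ge)
          fix q assume "q \<in> C"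
          then show "u (r *\<^sub>R x) / r \<le> q x"
            using u_le[of q "r *\<^sub>R x"] sublinearD(2)[OF sub, of q r x] r
            by (simp add: field_simps)
        qed
        then show ?thesis using r by (simp add: field_simps)
      qed
      have "sublinear u" using add zero scale by (rule sublinearI)
      moreover have "u \<le> p"
        using u_le[OF q0] le_funD[OF le[OF q0]] by (intro le_funI) (rule order_trans)
      ultimately show ?thesis using u_le by (auto intro!: bexI[of _ u] le_funI)
    qed
  qed
  then obtain m where m: "sublinear m" "m \<le> p" "\<And>a. sublinear a \<Longrightarrow> a \<le> p \<Longrightarrow> a \<le> m \<Longrightarrow> a = m"
    by auto
  then show ?thesis by (intro that[of m]) (auto intro: order_trans)
qed

text \<open>By minimality \<open>q\<close> equals its descent along every \<open>z\<close>; the parameter \<open>t = 1\<close> then reads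
  \<open>q x \<le> q (x + z) - q z\<close>, the converse of subadditivity.\<close>

lemma minimal_sublinear_linear:
  assumes q: "sublinear q" and min: "\<And>q'. sublinear q' \<Longrightarrow> q' \<le> q \<Longrightarrow> q' = q"
  shows "linear q"
proof -
  have eq: "sublinear_descent q z = q" for z
  proof (rule min[OF sublinear_sublinear_descent[OF q]])
    show "sublinear_descent q z \<le> q"
      using sublinear_descent_le[OF q, of 0 z] by (auto intro!: le_funI)
  qed
  have add: "q (x + z) = q x + q z" for x z
    using sublinear_descent_le[OF q, of 1 z x] sublinearD(1)[OF q, of x z] by (simp add: eq)
  have neg: "q (- x) = - q x" for x
    using add[of x "- x"] sublinearD(3)[OF q] by simp
  have "q (r *\<^sub>R x) = r * q x" for r x
  proof (cases "0 \<le> r")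
    case False
    then have "q ((- r) *\<^sub>R x) = (- r) * q x" by (intro sublinearD(2)[OF q]) simp
    then show ?thesis using neg[of "r *\<^sub>R x"] by simp
  qed (rule sublinearD(2)[OF q])
  with add show ?thesis by (intro linearI) simp_all
qed

text \<open>A minimal functional below the descent of \<open>p\<close> along \<open>z\<close> is linear, and being at most \<open>- p z\<close> at
  \<open>- z\<close> it attains \<open>p z\<close> at \<open>z\<close>.\<close>

theorem hahn_banach_sublinear:
  assumes p: "sublinear p"
  obtains f where "linear f" "\<And>x. f x \<le> p x" "f z = p z"
proof -
  obtain f where f: "sublinear f" "f \<le> sublinear_descent p z"
    "\<And>q'. sublinear q' \<Longrightarrow> q' \<le> f \<Longrightarrow> q' = f"
    using ex_minimal_sublinear[OF sublinear_sublinear_descent[OF p]] by metis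
  have lin: "linear f" using f(1,3) by (rule minimal_sublinear_linear)
  have le: "f x \<le> p x" for x
    using le_funD[OF f(2), of x] sublinear_descent_le[OF p, of 0 z x] by simp
  have "f (- z) \<le> - p z"
    using le_funD[OF f(2), of "- z"] sublinear_descent_le[OF p, of 1 z "- z"]
    by (simp add: sublinearD(3)[OF p])
  then have "f z = p z" using le[of z] linear_neg[OF lin, of z] by simp
  with lin le show ?thesis by (rule that)
qed

section \<open>Bounded complex functionals\<close>

definition bounded_functional :: "('a::complex_banach \<Rightarrow> complex) \<Rightarrow> bool" where
  "bounded_functional f \<longleftrightarrow> (\<forall>x y. f (x + y) = f x + f y) \<and> (\<forall>c x. f (c *\<^sub>C x) = c * f x) \<and>
     (\<exists>K. \<forall>x. cmod (f x) \<le> K * norm x)"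

lemma sublinear_infdist:
  fixes M :: "'a::real_normed_vector set"
  assumes M: "subspace M"
  shows "sublinear (\<lambda>x. infdist x M)"
proof (rule sublinearI)
  have ne: "M \<noteq> {}" using subspace_0[OF M] by auto
  have ge: "m \<le> infdist x M" if "\<And>a. a \<in> M \<Longrightarrow> m \<le> dist x a" for m x
    using that ne by (auto simp: infdist_notempty intro!: cINF_greatest)
  show "infdist 0 M = 0" using subspace_0[OF M] by simp
  fix x y :: 'a
  have sum: "infdist (x + y) M \<le> dist x a + dist y b" if "a \<in> M" "b \<in> M" for a b
    using infdist_le[OF subspace_add[OF M that], of "x + y"] dist_triangle_add[of x y a b] by linarith
  have "infdist (x + y) M - dist x a \<le> infdist y M" if "a \<in> M" for a
    by (rule ge) (use sum[OF that] in \<open>simp add: diff_le_eq add.commute\<close>)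
  then have "infdist (x + y) M - infdist y M \<le> infdist x M"
    by (intro ge) (simp add: diff_le_eq add.commute)
  then show "infdist (x + y) M \<le> infdist x M + infdist y M" by simp
  fix r :: real assume r: "0 < r"
  have "infdist (r *\<^sub>R x) M / r \<le> infdist x M"
  proof (rule ge)
    fix a assume "a \<in> M"
    then have "infdist (r *\<^sub>R x) M \<le> dist (r *\<^sub>R x) (r *\<^sub>R a)"
      by (intro infdist_le subspace_scale[OF M])
    also have "\<dots> = r * dist x a"
      using r by (simp add: dist_norm flip: scaleR_diff_right)
    finally show "infdist (r *\<^sub>R x) M / r \<le> dist x a" using r by (simp add: field_simps)
  qed
  then show "infdist (r *\<^sub>R x) M \<le> r * infdist x M" using r by (simp add: field_simps)
qed

text \<open>A complex functional is determined by its real part \<open>h\<close> through \<open>x \<mapsto> h x - \<i> h (\<i> x)\<close>.\<close>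

lemma bounded_functional_complexify:
  fixes f :: "'a::complex_banach \<Rightarrow> real"
  assumes lin: "linear f" and bound: "\<And>x. \<bar>f x\<bar> \<le> norm x"
  shows "bounded_functional (\<lambda>x. Complex (f x) (- f (\<i> *\<^sub>C x)))"
  unfolding bounded_functional_def
proof (intro conjI allI exI[of _ 2])
  fix x y :: 'a and c :: complex
  show "Complex (f (x + y)) (- f (\<i> *\<^sub>C (x + y))) =
      Complex (f x) (- f (\<i> *\<^sub>C x)) + Complex (f y) (- f (\<i> *\<^sub>C y))"
    by (simp add: complex_eq_iff linear_add[OF lin] scaleC_add_right)
  have split: "c *\<^sub>C z = Re c *\<^sub>R z + Im c *\<^sub>R (\<i> *\<^sub>C z)" for z :: 'a
    using complex_eq[of c]
    by (simp add: scaleR_scaleC scaleC_scaleC mult.commute flip: scaleC_add_left)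
  have rot: "\<i> *\<^sub>C c *\<^sub>C x = Re c *\<^sub>R (\<i> *\<^sub>C x) + - (Im c *\<^sub>R x)"
  proof -
    have "\<i> *\<^sub>C \<i> *\<^sub>C x = - x"
      using scaleR_scaleC[of "- 1" x] by (simp add: scaleC_scaleC)
    moreover have "\<i> *\<^sub>C c *\<^sub>C x = c *\<^sub>C \<i> *\<^sub>C x" by (simp add: scaleC_scaleC mult.commute)
    ultimately show ?thesis by (simp add: split[of "\<i> *\<^sub>C x"])
  qed
  show "Complex (f (c *\<^sub>C x)) (- f (\<i> *\<^sub>C c *\<^sub>C x)) = c * Complex (f x) (- f (\<i> *\<^sub>C x))"
    unfolding rot unfolding split[of x]
    by (simp add: complex_eq_iff linear_add[OF lin] linear_scale[OF lin] linear_neg[OF lin] linear_diff[OF lin] algebra_simps)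
  have "cmod (Complex (f x) (- f (\<i> *\<^sub>C x))) \<le> \<bar>f x\<bar> + \<bar>f (\<i> *\<^sub>C x)\<bar>"
    using cmod_le[of "Complex (f x) (- f (\<i> *\<^sub>C x))"] by simp
  also have "\<dots> \<le> 2 * norm x" using bound[of x] bound[of "\<i> *\<^sub>C x"] by (simp add: norm_scaleC)
  finally show "cmod (Complex (f x) (- f (\<i> *\<^sub>C x))) \<le> 2 * norm x" .
qed

lemma bounded_functionalD:
  assumes "bounded_functional f"
  shows "f (x + y) = f x + f y" "f (c *\<^sub>C x) = c * f x" "f 0 = 0"
proof -
  show add: "f (x + y) = f x + f y" for x y using assms by (simp add: bounded_functional_def)
  show "f (c *\<^sub>C x) = c * f x" using assms by (simp add: bounded_functional_def)
  show "f 0 = 0" using add[of 0 0] by simp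
qed

text \<open>The distance to \<open>M\<close> is sublinear and positive at \<open>z\<close>; a real functional dominated by it and
  equal to it at \<open>z\<close> vanishes on \<open>M\<close>, and so does its complexification, \<open>M\<close> being a complex
  subspace.\<close>

theorem hahn_banach_separation:
  fixes M :: "'a::complex_banach set"
  assumes M: "subspace M" and M_scaleC: "\<And>c x. x \<in> M \<Longrightarrow> c *\<^sub>C x \<in> M" and z: "z \<notin> closure M"
  obtains f where "bounded_functional f" "\<And>x. x \<in> M \<Longrightarrow> f x = 0" "f z = 1"
proof -
  obtain h where lin: "linear h" and le: "\<And>x. h x \<le> infdist x M" and hz: "h z = infdist z M"
    using hahn_banach_sublinear[OF sublinear_infdist[OF M], of z] by metis
  have hM: "h x = 0" if "x \<in> M" for x
    using le[of x] le[of "- x"] that subspace_neg[OF M that] by (simp add: linear_neg[OF lin])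
  have "h x \<le> norm x" for x
    using le[of x] infdist_le[OF subspace_0[OF M], of x] by simp
  from this this[of "- x" for x] have bound: "\<bar>h x\<bar> \<le> norm x" for x
    by (simp add: linear_neg[OF lin] abs_le_iff)
  have "0 < h z"
    unfolding hz using z infdist_nonneg[of z M] in_closure_iff_infdist_zero[of M z] subspace_0[OF M] by fastforce
  define F where "F x = Complex (h x) (- h (\<i> *\<^sub>C x))" for x
  have F: "bounded_functional F"
    unfolding F_def using lin bound by (rule bounded_functional_complexify)
  have Fz: "F z \<noteq> 0" using \<open>0 < h z\<close> by (simp add: F_def complex_eq_iff)
  show ?thesis
  proof (rule that[of "\<lambda>x. F x / F z"])
    from F obtain K where "\<And>x. cmod (F x) \<le> K * norm x" by (auto simp: bounded_functional_def)
    then have "cmod (F x / F z) \<le> (K / cmod (F z)) * norm x" for x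
      using Fz by (simp add: norm_divide divide_right_mono)
    then show "bounded_functional (\<lambda>x. F x / F z)"
      unfolding bounded_functional_def
      by (intro conjI exI[of _ "K / cmod (F z)"])
         (simp_all add: bounded_functionalD[OF F] add_divide_distrib)
    have "F x = 0" if "x \<in> M" for x
      using hM[OF that] hM[OF M_scaleC[OF that]] by (simp add: F_def complex_eq_iff)
    then show "F x / F z = 0" if "x \<in> M" for x using that by simp
    show "F z / F z = 1" using Fz by simp
  qed
qed

corollary ex_functional_eq_1:
  assumes "(v::'a::complex_banach) \<noteq> 0"
  obtains f where "bounded_functional f" "f v = 1"
proof -
  have "c *\<^sub>C 0 = (0::'a)" for c
    using norm_scaleC[of c "0::'a"] by simp
  with assms that show ?thesis
    using hahn_banach_separation[of "{0}" v] by (auto simp: subspace_def)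
qed

section \<open>Rank one operators and large scalar perturbations\<close>

lemma bop_apply_scaleC: "bop_apply A (c *\<^sub>C x) = c *\<^sub>C bop_apply A x"
  by transfer simp

lemma linear_bop_apply: "linear (bop_apply A)"
  by transfer (rule bounded_linear.linear[OF blinfun.bounded_linear_right])

lemma bop_apply_bounded: "\<exists>K. \<forall>x. norm (bop_apply A x) \<le> K * norm x"
  by transfer (metis norm_blinfun)

definition rank_one :: "'a \<Rightarrow> ('a \<Rightarrow> complex) \<Rightarrow> 'a::complex_banach bop" where
  "rank_one y g = Bop (Blinfun (\<lambda>x. g x *\<^sub>C y))"

lemma bop_apply_rank_one:
  assumes g: "bounded_functional g"
  shows "bop_apply (rank_one y g) x = g x *\<^sub>C y"
proof -
  obtain K where K: "\<And>x. cmod (g x) \<le> K * norm x"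
    using g by (auto simp: bounded_functional_def)
  have bl: "bounded_linear (\<lambda>x. g x *\<^sub>C y)"
  proof (rule bounded_linear_intro[where K = "K * norm y"])
    fix x show "norm (g x *\<^sub>C y) \<le> norm x * (K * norm y)"
      using mult_right_mono[OF K[of x], of "norm y"] by (simp add: norm_scaleC mult_ac)
  qed (simp_all add: bounded_functionalD[OF g] scaleC_add_left scaleR_scaleC scaleC_scaleC)
  show ?thesis
    unfolding rank_one_def bop_apply_def map_fun_def comp_def id_def
    by (subst Bop_inverse)
       (simp_all add: bounded_linear_Blinfun_apply[OF bl] bounded_functionalD[OF g] scaleC_scaleC)
qed

lemma bounded_functional_comp:
  assumes g: "bounded_functional g"
  shows "bounded_functional (\<lambda>x. g (bop_apply A x))"
proof -
  obtain K where K: "\<And>x. cmod (g x) \<le> K * norm x"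
    using g by (auto simp: bounded_functional_def)
  obtain L where L: "\<And>x. norm (bop_apply A x) \<le> L * norm x"
    using bop_apply_bounded by blast
  have "cmod (g (bop_apply A x)) \<le> (\<bar>K\<bar> * L) * norm x" for x
  proof -
    have "cmod (g (bop_apply A x)) \<le> \<bar>K\<bar> * norm (bop_apply A x)"
      using K[of "bop_apply A x"] by (meson abs_ge_self mult_right_mono norm_ge_zero order_trans)
    also have "\<dots> \<le> \<bar>K\<bar> * (L * norm x)" by (intro mult_left_mono L) simp
    finally show ?thesis by (simp add: mult.assoc)
  qed
  then show ?thesis
    unfolding bounded_functional_def
    by (auto simp: bop_apply_add bop_apply_scaleC bounded_functionalD[OF g])
qed

text \<open>The equation \<open>(A + r) s = 1\<close> is the fixed point equation \<open>s = (1 - A s) / r\<close>, a contraction as soon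
  as \<open>r \<ge> 2 \<parallel>A\<parallel>\<close>. The iteration takes place in the closed set of complex linear maps inside the
  Banach space of real linear bounded maps.\<close>

lemma ex_right_inverse_large_scalar:
  fixes A :: "'a::complex_banach bop"
  obtains c S where "c \<noteq> 0" "(A + c *\<^sub>C 1) * S = 1"
proof -
  define a where "a = blinfun_of_bop A"
  define X where "X = {f::'a \<Rightarrow>\<^sub>L 'a. \<forall>c x. blinfun_apply f (c *\<^sub>C x) = c *\<^sub>C blinfun_apply f x}"
  \<comment> \<open>The summand \<open>1\<close> keeps \<open>r\<close> positive when \<open>A = 0\<close>.\<close>
  define r where "r = 2 * norm a + 1"
  have r: "r > 0" using norm_ge_zero[of a] unfolding r_def by linarith
  then have half: "norm a / r \<le> 1/2" by (simp add: r_def divide_le_eq)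
  define T where "T s = inverse r *\<^sub>R (id_blinfun - (a o\<^sub>L s))" for s :: "'a \<Rightarrow>\<^sub>L 'a"
  have aX: "blinfun_apply a (c *\<^sub>C x) = c *\<^sub>C blinfun_apply a x" for c x
    using blinfun_of_bop[of A] by (simp add: a_def)
  have "\<exists>!s\<in>X. T s = s"
  proof (rule Banach_fix[where c = "1/2"])
    have "X = (\<Inter>c. \<Inter>x. {f. blinfun_apply f (c *\<^sub>C x) = c *\<^sub>C blinfun_apply f x})"
      by (auto simp: X_def)
    moreover have "closed {f::'a \<Rightarrow>\<^sub>L 'a. blinfun_apply f (c *\<^sub>C x) = c *\<^sub>C blinfun_apply f x}" for c x
      by (intro closed_Collect_eq continuous_intros
          bounded_linear.continuous_on[OF bounded_linear_scaleC])
    ultimately show "complete X"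
      by (simp add: complete_eq_closed closed_INT)
    show "X \<noteq> {}" by (auto simp: X_def intro!: exI[of _ id_blinfun])
    show "T ` X \<subseteq> X"
      by (auto simp: T_def X_def aX blinfun.scaleR_left blinfun.diff_left scaleR_scaleC scaleC_scaleC mult.commute
         linear_diff[OF bounded_linear.linear[OF bounded_linear_scaleC]])
    fix s t assume "s \<in> X" "t \<in> X"
    have "T s - T t = inverse r *\<^sub>R (a o\<^sub>L (t - s))"
    proof (rule blinfun_eqI)
      fix x
      have "blinfun_apply (T s - T t) x =
          inverse r *\<^sub>R ((x - blinfun_apply a (blinfun_apply s x)) - (x - blinfun_apply a (blinfun_apply t x)))"
        by (simp only: T_def blinfun.scaleR_left blinfun.diff_left scaleR_diff_right
            blinfun_apply_blinfun_compose blinfun_apply_id_blinfun id_apply)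
      then show "blinfun_apply (T s - T t) x = blinfun_apply (inverse r *\<^sub>R (a o\<^sub>L (t - s))) x"
        by (simp only: blinfun.scaleR_left blinfun.diff_left blinfun.diff_right
            blinfun_apply_blinfun_compose) simp
    qed
    then have "dist (T s) (T t) \<le> inverse r * (norm a * norm (t - s))"
      using r norm_blinfun_compose[of a "t - s"] by (simp add: dist_norm)
    also have "\<dots> = (norm a / r) * dist s t"
      by (simp add: dist_norm norm_minus_commute field_simps)
    also have "\<dots> \<le> 1/2 * dist s t" using half by (intro mult_right_mono) auto
    finally show "dist (T s) (T t) \<le> 1/2 * dist s t" .
  qed auto
  then obtain s where "s \<in> X" and s: "T s = s" by blast
  show ?thesis
  proof (rule that[of "complex_of_real r" "Bop s"])
    show "complex_of_real r \<noteq> 0" using r by simp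
    have app: "bop_apply (Bop s) x = blinfun_apply s x" "blinfun_apply a x = bop_apply A x" for x
      using \<open>s \<in> X\<close> unfolding bop_apply_def by (simp_all add: Bop_inverse X_def a_def)
    have "r *\<^sub>R blinfun_apply s x = x - bop_apply A (blinfun_apply s x)" for x
      using r arg_cong[OF s, of "\<lambda>f. r *\<^sub>R blinfun_apply f x"]
      by (simp add: T_def blinfun.scaleR_left blinfun.diff_left app)
    then show "(A + complex_of_real r *\<^sub>C 1) * Bop s = 1"
      by (intro bop_eqI) (simp add: bop_apply_simps app flip: scaleR_scaleC)
  qed
qed

section \<open>Scalars, Lie products and zero products\<close>

lemma scaleC_mult_bop:
  fixes A B :: "'a::complex_banach bop"
  shows "(c *\<^sub>C A) * B = c *\<^sub>C (A * B)" "A * (c *\<^sub>C B) = c *\<^sub>C (A * B)"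
  by (rule bop_eqI, simp add: bop_apply_simps bop_apply_scaleC)+

interpretation complex_scale: module "scaleC :: complex \<Rightarrow> 'a::complex_vector \<Rightarrow> 'a"
  by unfold_locales (rule scaleC_add_right scaleC_add_left scaleC_scaleC scaleC_one)+

lemma scalar_opsI [simp]: "c *\<^sub>C 1 \<in> scalar_ops"
  by (auto simp: scalar_ops_def)

lemma scalar_ops_add: "A \<in> scalar_ops \<Longrightarrow> B \<in> scalar_ops \<Longrightarrow> A + B \<in> scalar_ops"
  unfolding scalar_ops_def by clarify (metis scaleC_add_left)

lemma lie_product_add_scalar: "S \<in> scalar_ops \<Longrightarrow> lie_product (A + S) B = lie_product A B"
  "S \<in> scalar_ops \<Longrightarrow> lie_product A (B + S) = lie_product A B"
  by (auto simp: scalar_ops_def lie_product_def algebra_simps scaleC_mult_bop)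

lemma lie_product_scaleC:
  fixes A B :: "'a::complex_banach bop"
  shows "lie_product (c *\<^sub>C A) B = c *\<^sub>C lie_product A B"
  "lie_product A (c *\<^sub>C B) = c *\<^sub>C lie_product A B"
  by (simp_all add: lie_product_def scaleC_mult_bop complex_scale.scale_right_diff_distrib)

text \<open>The condition that Lie centralizability at \<open>W\<close> imposes on factorizations of \<open>W\<close>, here for a
  single pair with arbitrary product; it will be used for pairs with product zero.\<close>

definition lie_central_pair :: "('a::ring \<Rightarrow> 'a) \<Rightarrow> 'a \<Rightarrow> 'a \<Rightarrow> bool" where
  "lie_central_pair \<phi> A D \<longleftrightarrow>
     \<phi> (lie_product A D) = lie_product (\<phi> A) D \<and> lie_product (\<phi> A) D = lie_product A (\<phi> D)"

text \<open>Both \<open>(A, B)\<close> and \<open>(A, B + D)\<close> factorize \<open>W\<close>, and the condition is additive in the second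
  factor.\<close>

lemma lie_central_pair_if_zero_product:
  fixes \<phi> :: "'a::ring \<Rightarrow> 'a"
  assumes "additive \<phi>" "lie_centralizable_at \<phi> W" "A * B = W" "A * D = 0"
  shows "lie_central_pair \<phi> A D"
proof -
  interpret additive \<phi> by fact
  have lie_add: "lie_product X (Y + Z) = lie_product X Y + lie_product X Z" for X Y Z :: 'a
    by (simp add: lie_product_def algebra_simps)
  have "A * (B + D) = W" using assms by (simp add: distrib_left)
  then have "\<phi> (lie_product A (B + D)) = lie_product (\<phi> A) (B + D)"
    "lie_product (\<phi> A) (B + D) = lie_product A (\<phi> (B + D))"
    and "\<phi> (lie_product A B) = lie_product (\<phi> A) B"
    "lie_product (\<phi> A) B = lie_product A (\<phi> B)"
    using assms(2,3) unfolding lie_centralizable_at_def by blast+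
  then show ?thesis by (simp add: lie_central_pair_def lie_add add)
qed

lemma lie_central_pair_diff:
  fixes \<phi> :: "'a::ring \<Rightarrow> 'a"
  assumes "additive \<phi>" "lie_central_pair \<phi> A D" "lie_central_pair \<phi> B D"
  shows "lie_central_pair \<phi> (A - B) D"
proof -
  interpret additive \<phi> by fact
  have "lie_product (X - Y) Z = lie_product X Z - lie_product Y Z" for X Y Z :: 'a
    by (simp add: lie_product_def algebra_simps)
  then show ?thesis using assms(2,3) by (simp add: lie_central_pair_def diff)
qed

section \<open>Additive maps and the Peirce decomposition\<close>

text \<open>With \<open>P = 1 - Q\<close>, membership in the Peirce components is expressed by equations:
  \<open>A \<in> PRP\<close> by \<open>Q * A = 0\<close> and \<open>A * Q = 0\<close> (corner), \<open>D \<in> QRP\<close> by \<open>Q * D = D\<close> and \<open>D * Q = 0\<close>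
  (row), \<open>N \<in> PRQ\<close> by \<open>Q * N = 0\<close> and \<open>N * Q = N\<close> (column).\<close>

locale minimal_idempotent =
  fixes Q :: "'a::complex_banach bop"
  assumes idem: "Q * Q = Q"
    and scalar_corner: "\<exists>c. Q * A * Q = c *\<^sub>C Q"
    and faithful_left: "(\<And>B. Q * B * V = 0) \<Longrightarrow> V = 0"
    and faithful_right: "(\<And>B. V * B * Q = 0) \<Longrightarrow> V = 0"
begin

lemma idem_assoc: "Q * (Q * A) = Q * A"
  by (simp add: idem flip: mult.assoc)

lemma eq_zero_if_row_kills:
  assumes "\<And>D. Q * D = D \<Longrightarrow> D * Q = 0 \<Longrightarrow> D * V = 0" and "Q * V = 0"
  shows "V = 0"
proof (rule faithful_left)
  fix B
  have "Q * B * (1 - Q) * V = 0"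
    by (rule assms(1)) (simp_all add: algebra_simps idem idem_assoc)
  then show "Q * B * V = 0" by (simp add: algebra_simps assms(2))
qed

lemma eq_zero_if_killed_by_column:
  assumes "\<And>N. Q * N = 0 \<Longrightarrow> N * Q = N \<Longrightarrow> V * N = 0" and "V * Q = 0"
  shows "V = 0"
proof (rule faithful_right)
  fix B
  have "V * ((1 - Q) * B * Q) = 0"
    by (rule assms(1)) (simp_all add: algebra_simps idem idem_assoc)
  then show "V * B * Q = 0" by (simp add: algebra_simps assms(2) flip: mult.assoc)
qed

text \<open>Some row \<open>D\<close> has \<open>D * N \<noteq> 0\<close>, and \<open>D * N\<close> lies in \<open>QRQ\<close>, so it is a nonzero multiple of \<open>Q\<close>.\<close>

lemma column_partner:
  assumes N: "Q * N = 0" "N * Q = N" and "N \<noteq> 0"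
  obtains G where "Q * G = G" "G * Q = 0" "G * N = Q"
proof -
  obtain D where D: "Q * D = D" "D * Q = 0" "D * N \<noteq> 0"
    using eq_zero_if_row_kills[of N] assms by blast
  obtain c where "Q * (D * N) * Q = c *\<^sub>C Q" using scalar_corner by blast
  moreover have "Q * (D * N) * Q = D * N" by (metis D(1) N(2) mult.assoc)
  ultimately have DN: "D * N = c *\<^sub>C Q" by simp
  then have "c \<noteq> 0" using D(3) by auto
  then show ?thesis
    by (intro that[of "inverse c *\<^sub>C D"]) (simp_all add: scaleC_mult_bop D DN)
qed

lemma ex_column_neq_0:
  assumes "Q \<noteq> 1"
  obtains N where "Q * N = 0" "N * Q = N" "N \<noteq> 0"
proof -
  have "\<exists>N. Q * N = 0 \<and> N * Q = N \<and> (1 - Q) * N \<noteq> 0"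
    using eq_zero_if_killed_by_column[of "1 - Q"] assms by (force simp: algebra_simps idem)
  then show ?thesis using that by fastforce
qed

text \<open>If \<open>G * N = Q\<close>, then for every column \<open>N'\<close> the operator \<open>N' * G\<close> lies in \<open>PRP\<close>, so
  \<open>T * N' = T * (N' * G) * N = N' * (G * T * N)\<close>. Thus \<open>T\<close> acts on columns as the scalar \<open>c\<close> with
  \<open>G * T * N = c Q\<close>.\<close>

lemma complementary_corner_center:
  assumes "Q \<noteq> 1" and T: "Q * T = 0" "T * Q = 0"
    and comm: "\<And>A. Q * A = 0 \<Longrightarrow> A * Q = 0 \<Longrightarrow> T * A = A * T"
  obtains c where "T = c *\<^sub>C (1 - Q)"
proof -
  obtain N where N: "Q * N = 0" "N * Q = N" "N \<noteq> 0"
    using ex_column_neq_0[OF assms(1)] .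
  obtain G where G: "Q * G = G" "G * Q = 0" "G * N = Q"
    using column_partner[OF N] .
  obtain c where c: "Q * (G * T * N) * Q = c *\<^sub>C Q" using scalar_corner by blast
  then have c: "G * T * N = c *\<^sub>C Q" by (metis G(1) N(2) mult.assoc)
  have "T - c *\<^sub>C (1 - Q) = 0"
  proof (rule eq_zero_if_killed_by_column)
    fix N' assume N': "Q * N' = 0" "N' * Q = N'"
    have "T * (N' * G) = N' * G * T"
    proof (rule comm)
      show "Q * (N' * G) = 0" using N'(1) by (simp flip: mult.assoc)
      show "N' * G * Q = 0" using G(2) by (simp add: mult.assoc)
    qed
    then have "T * (N' * (G * N)) = N' * (G * T * N)" by (metis mult.assoc)
    then have "T * N' = c *\<^sub>C N'" by (simp add: c G(3) N' scaleC_mult_bop)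
    then show "(T - c *\<^sub>C (1 - Q)) * N' = 0"
      by (simp add: algebra_simps scaleC_mult_bop N')
  qed (simp add: algebra_simps scaleC_mult_bop idem T)
  then show ?thesis using that by simp
qed

text \<open>Let \<open>Z = \<phi> P\<close>. The pair \<open>(P, D)\<close> gives \<open>\<phi> D = D * Z - Z * D\<close> for rows \<open>D\<close>, where \<open>Z * D\<close> is a
  multiple of \<open>D\<close>. The pairs \<open>(A, D)\<close> with \<open>A \<in> PRP\<close> then force \<open>Z\<close> to commute with \<open>PRP\<close>, so
  that \<open>Z\<close> acts on rows as a scalar too; read once more, the same pairs determine \<open>\<phi> A\<close> up to
  scalars from the known value \<open>\<phi> (D * A) = l (D * A)\<close>.\<close>

lemma lie_centralizer_on_corner:
  fixes \<phi> :: "'a bop \<Rightarrow> 'a bop"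
  assumes "additive \<phi>" and "Q \<noteq> 1"
    and pair: "\<And>A D. Q * A = 0 \<Longrightarrow> A * Q = 0 \<Longrightarrow> Q * D = D \<Longrightarrow> lie_central_pair \<phi> A D"
  obtains l where "\<And>D. Q * D = D \<Longrightarrow> D * Q = 0 \<Longrightarrow> \<phi> D = l *\<^sub>C D"
    and "\<And>A. Q * A = 0 \<Longrightarrow> A * Q = 0 \<Longrightarrow> \<phi> A - l *\<^sub>C A \<in> scalar_ops"
proof -
  interpret additive \<phi> by fact
  \<comment> \<open>The pair \<open>(A, Q)\<close> has Lie product zero, so \<open>[\<phi> A, Q] = \<phi> 0 = 0\<close>.\<close>
  have comm_Q: "\<phi> A * Q = Q * \<phi> A" if "Q * A = 0" "A * Q = 0" for A
    using pair[OF that idem] that by (simp add: lie_central_pair_def lie_product_def zero)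
  define Z where "Z = \<phi> (1 - Q)"
  have P: "Q * (1 - Q) = 0" "(1 - Q) * Q = 0" by (simp_all add: algebra_simps idem)
  have ZQ: "Z * Q = Q * Z" unfolding Z_def by (rule comm_Q[OF P])
  obtain \<zeta> where "Q * Z * Q = \<zeta> *\<^sub>C Q" using scalar_corner by blast
  then have \<zeta>: "Z * Q = \<zeta> *\<^sub>C Q" by (simp add: ZQ idem mult.assoc flip: ZQ)
  have AD: "A * D = 0" if "A * Q = 0" "Q * D = D" for A D
    using that by (metis mult.assoc mult_zero_left)
  have \<phi>D: "\<phi> D = D * Z - \<zeta> *\<^sub>C D" if D: "Q * D = D" "D * Q = 0" for D
  proof -
    have "Z * D = \<zeta> *\<^sub>C D" by (metis D(1) \<zeta> mult.assoc scaleC_mult_bop(1))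
    moreover have "lie_product (1 - Q) D = - D"
      by (simp add: lie_product_def algebra_simps D)
    then have "\<phi> (- D) = Z * D - D * Z"
      using pair[OF P D(1)] by (simp add: lie_central_pair_def lie_product_def Z_def)
    ultimately show ?thesis by (simp add: minus algebra_simps minus_equation_iff)
  qed
  have DA: "Q * (D * A) = D * A" "D * A * Q = 0" if "Q * D = D" "A * Q = 0" for D A
    using that by (simp_all add: mult.assoc) (simp flip: mult.assoc)
  have ZA: "Z * A = A * Z" if A: "Q * A = 0" "A * Q = 0" for A
  proof -
    have "Z * A - A * Z = 0"
    proof (rule eq_zero_if_row_kills)
      fix D assume D: "Q * D = D" "D * Q = 0"
      have "lie_product A D = - (D * A)" by (simp add: lie_product_def AD A D)
      moreover have "A * (D * Z) = 0" using AD[OF A(2) D(1)] by (simp flip: mult.assoc)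
      then have "lie_product A (\<phi> D) = - (\<phi> D * A)"
        by (simp add: lie_product_def \<phi>D[OF D] AD[OF A(2) D(1)] right_diff_distrib scaleC_mult_bop)
      ultimately have "\<phi> (D * A) = \<phi> D * A"
        using pair[OF A D(1)] by (metis lie_central_pair_def minus neg_equal_iff_equal)
      then show "D * (Z * A - A * Z) = 0"
        by (simp add: \<phi>D D DA A algebra_simps scaleC_mult_bop)
    next
      show "Q * (Z * A - A * Z) = 0"
        by (simp add: algebra_simps flip: mult.assoc ZQ) (simp add: mult.assoc A)
    qed
    then show ?thesis by simp
  qed
  obtain c where c: "Z - Z * Q = c *\<^sub>C (1 - Q)"
  proof (rule complementary_corner_center[OF \<open>Q \<noteq> 1\<close>, of "Z - Z * Q"])
    show "Q * (Z - Z * Q) = 0"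
      by (simp add: algebra_simps flip: mult.assoc) (simp add: mult.assoc idem flip: ZQ)
    show "(Z - Z * Q) * Q = 0" by (simp add: algebra_simps idem)
    fix A assume A: "Q * A = 0" "A * Q = 0"
    have "A * (Z * Q) = 0" by (simp add: ZQ A flip: mult.assoc)
    then show "(Z - Z * Q) * A = A * (Z - Z * Q)" by (simp add: algebra_simps A ZA)
  qed
  define l where "l = c - \<zeta>"
  have \<phi>D: "\<phi> D = l *\<^sub>C D" if D: "Q * D = D" "D * Q = 0" for D
  proof -
    have "D * (Z - Z * Q) = c *\<^sub>C D"
      by (simp add: c algebra_simps scaleC_mult_bop D)
    then have "D * Z = c *\<^sub>C D" by (simp add: \<zeta> algebra_simps scaleC_mult_bop D)
    then show ?thesis by (simp add: \<phi>D[OF D] l_def complex_scale.scale_left_diff_distrib)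
  qed
  moreover have "\<phi> A - l *\<^sub>C A \<in> scalar_ops" if A: "Q * A = 0" "A * Q = 0" for A
  proof -
    obtain \<alpha> where "Q * \<phi> A * Q = \<alpha> *\<^sub>C Q" using scalar_corner by blast
    then have \<alpha>: "\<phi> A * Q = \<alpha> *\<^sub>C Q" "Q * \<phi> A = \<alpha> *\<^sub>C Q"
      using comm_Q[OF A] by (simp_all add: mult.assoc idem_assoc)
    have "\<phi> A - \<alpha> *\<^sub>C 1 - l *\<^sub>C A = 0"
    proof (rule eq_zero_if_row_kills)
      fix D assume D: "Q * D = D" "D * Q = 0"
      have "\<phi> A * D = \<alpha> *\<^sub>C D" by (metis D(1) \<alpha>(1) mult.assoc scaleC_mult_bop(1))
      moreover have "lie_product A D = - (D * A)" by (simp add: lie_product_def AD A D)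
      ultimately have "- (l *\<^sub>C (D * A)) = \<alpha> *\<^sub>C D - D * \<phi> A"
        using pair[OF A D(1)]
        by (simp add: lie_central_pair_def lie_product_def minus \<phi>D DA D A)
      then show "D * (\<phi> A - \<alpha> *\<^sub>C 1 - l *\<^sub>C A) = 0"
        by (simp add: algebra_simps scaleC_mult_bop)
    qed (simp add: algebra_simps scaleC_mult_bop A \<alpha>)
    then show ?thesis by (simp add: algebra_simps)
  qed
  ultimately show ?thesis by (rule that)
qed

text \<open>\<open>G + N * G = (Q + N) * G\<close>, and \<open>Q + N\<close> is idempotent.\<close>

lemma sheared_product_eq_0:
  assumes N: "Q * N = 0" "N * Q = N" and G: "Q * G = G"
  shows "(1 - Q - N) * (G + N * G) = 0"
proof -
  have "N * (N * G) = 0" using N by (metis mult.assoc mult_zero_right mult_zero_left)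
  moreover have "Q * (N * G) = 0" using N by (simp flip: mult.assoc)
  ultimately show ?thesis by (simp add: algebra_simps G)
qed

text \<open>It remains to control columns and \<open>QRQ\<close>. For this the Peirce decomposition is sheared by a
  column \<open>N\<close>: the product \<open>((Q + N) * G) * (1 - Q - N)\<close> expands to
  \<open>G - G * N + N * G - N * G * N\<close>, which meets all four components.\<close>

lemma lie_centralizer_eq_scaling_plus_scalar:
  fixes \<phi> :: "'a bop \<Rightarrow> 'a bop"
  assumes "additive \<phi>" and "Q \<noteq> 1"
    and pair: "\<And>A D. Q * A = 0 \<Longrightarrow> A * Q = 0 \<Longrightarrow> Q * D = D \<Longrightarrow> lie_central_pair \<phi> A D"
    and sheared_pair: "\<And>N G. Q * N = 0 \<Longrightarrow> N * Q = N \<Longrightarrow> Q * G = G \<Longrightarrow> G * Q = 0 \<Longrightarrow>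
      lie_central_pair \<phi> (1 - Q - N) (G + N * G)"
  shows "\<exists>l. \<forall>A. \<phi> A - l *\<^sub>C A \<in> scalar_ops"
proof -
  interpret additive \<phi> by fact
  obtain l where \<phi>_row: "\<And>D. Q * D = D \<Longrightarrow> D * Q = 0 \<Longrightarrow> \<phi> D = l *\<^sub>C D"
    and \<phi>_corner: "\<And>A. Q * A = 0 \<Longrightarrow> A * Q = 0 \<Longrightarrow> \<phi> A - l *\<^sub>C A \<in> scalar_ops"
    using lie_centralizer_on_corner[OF assms(1-3)] by blast
  define \<psi> where "\<psi> A = \<phi> A - l *\<^sub>C A" for A
  have \<psi>_add: "\<psi> (A + B) = \<psi> A + \<psi> B" for A B
    by (simp add: \<psi>_def add scaleC_add_right)
  then interpret \<psi>: additive \<psi> by unfold_locales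
  have row: "\<psi> D = 0" if "Q * D = D" "D * Q = 0" for D
    using \<phi>_row[OF that] by (simp add: \<psi>_def)
  have corner: "\<psi> A \<in> scalar_ops" if "Q * A = 0" "A * Q = 0" for A
    using \<phi>_corner[OF that] by (simp add: \<psi>_def)
  have NG: "Q * (N * G) = 0" "N * G * Q = 0" if "Q * N = 0" "G * Q = 0" for N G
    using that by (simp_all add: mult.assoc) (simp flip: mult.assoc)
  have shear: "\<psi> (N * G * N) = \<psi> (N * G) - \<psi> (G * N)"
    if N: "Q * N = 0" "N * Q = N" and G: "Q * G = G" "G * Q = 0" for N G
  proof -
    let ?A = "1 - Q - N" and ?D = "G + N * G"
    have lie: "lie_product ?A ?D = - (?D * ?A)"
      by (simp add: lie_product_def sheared_product_eq_0[OF N G(1)])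
    have "\<psi> ?D \<in> scalar_ops"
      using corner[OF NG[OF N(1) G(2)]] by (simp add: \<psi>_add row[OF G])
    then have "lie_product ?A (l *\<^sub>C ?D + \<psi> ?D) = l *\<^sub>C lie_product ?A ?D"
      by (simp add: lie_product_add_scalar lie_product_scaleC)
    then have "\<phi> (lie_product ?A ?D) = l *\<^sub>C lie_product ?A ?D"
      using sheared_pair[OF N G] by (simp add: lie_central_pair_def \<psi>_def)
    then have "\<psi> (?D * ?A) = 0"
      by (simp add: \<psi>_def lie minus)
    moreover have "?D * ?A = G - G * N + N * G - N * G * N"
      using G(2) by (simp add: algebra_simps)
    ultimately show ?thesis by (simp add: \<psi>_add \<psi>.diff row[OF G])
  qed
  have shear_0: "\<psi> (N * G * N) = 0"
    if N: "Q * N = 0" "N * Q = N" and G: "Q * G = G" "G * Q = 0" for N G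
  proof -
    let ?Y = "\<psi> (N * G * N)"
    \<comment> \<open>Replacing \<open>N\<close> by \<open>2 N\<close> multiplies one side of \<open>shear\<close> by 4 and the other by 2.\<close>
    have "\<psi> ((N + N) * G * (N + N)) = \<psi> ((N + N) * G) - \<psi> (G * (N + N))"
      by (rule shear) (simp_all add: distrib_left distrib_right N G)
    then have "?Y + ?Y + (?Y + ?Y) = \<psi> (N * G) + \<psi> (N * G) - (\<psi> (G * N) + \<psi> (G * N))"
      by (simp add: distrib_left distrib_right \<psi>_add)
    also have "\<dots> = ?Y + ?Y" by (simp add: shear[OF N G])
    finally have "?Y + ?Y + (?Y + ?Y) = ?Y + ?Y" .
    then have "2 *\<^sub>R ?Y = 0" by (simp add: scaleR_2)
    then show ?thesis by simp
  qed
  have column: "\<psi> N = 0" if N: "Q * N = 0" "N * Q = N" for N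
  proof (cases "N = 0")
    case False
    obtain G where G: "Q * G = G" "G * Q = 0" "G * N = Q" using column_partner[OF N False] .
    then show ?thesis using shear_0[OF N G(1,2)] N(2) by (simp add: mult.assoc)
  qed (simp add: \<psi>.zero)
  \<comment> \<open>Since \<open>\<psi> (N * G * N) = 0\<close>, the identity \<open>shear\<close> says that \<open>\<psi>\<close> takes the same value at
    \<open>G * N \<in> QRQ\<close> and at \<open>N * G \<in> PRP\<close>, where it is scalar.\<close>
  obtain N where N: "Q * N = 0" "N * Q = N" "N \<noteq> 0" using ex_column_neq_0[OF \<open>Q \<noteq> 1\<close>] .
  obtain G where G: "Q * G = G" "G * Q = 0" "G * N = Q" using column_partner[OF N] .
  have diagonal: "\<psi> (c *\<^sub>C Q) \<in> scalar_ops" for c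
  proof -
    have cG: "Q * (c *\<^sub>C G) = c *\<^sub>C G" "(c *\<^sub>C G) * Q = 0" by (simp_all add: scaleC_mult_bop G)
    have "\<psi> ((c *\<^sub>C G) * N) = \<psi> (N * (c *\<^sub>C G))"
      using shear[OF N(1,2) cG] shear_0[OF N(1,2) cG] by simp
    then show ?thesis
      using corner[OF NG[OF N(1) cG(2)]] by (simp add: scaleC_mult_bop G(3))
  qed
  have "\<psi> A \<in> scalar_ops" for A
  proof -
    obtain c where c: "Q * A * Q = c *\<^sub>C Q" using scalar_corner by blast
    have "A = (1 - Q) * A * (1 - Q) + (1 - Q) * A * Q + Q * A * (1 - Q) + c *\<^sub>C Q"
      unfolding c[symmetric] by (simp add: algebra_simps)
    moreover have "\<psi> ((1 - Q) * A * (1 - Q)) \<in> scalar_ops"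
      by (rule corner) (simp_all add: algebra_simps idem idem_assoc)
    moreover have "\<psi> ((1 - Q) * A * Q) = 0"
      by (rule column) (simp_all add: algebra_simps idem idem_assoc)
    moreover have "\<psi> (Q * A * (1 - Q)) = 0"
      by (rule row) (simp_all add: algebra_simps idem idem_assoc)
    ultimately show ?thesis
      using diagonal[of c] by (metis \<psi>_add add.right_neutral scalar_ops_add)
  qed
  then show ?thesis unfolding \<psi>_def by blast
qed

section \<open>Factorizing an operator that is annihilated by an idempotent\<close>

text \<open>All pairs needed in the Peirce computation are obtained by exhibiting the left factor as a left
  divisor of \<open>W\<close>. Since \<open>(1 - Q) * W = W\<close>, it is enough to find right inverses up to the factor
  \<open>1 - Q\<close>.\<close>

lemma lie_centralizable_at_left_annihilated:
  fixes \<phi> :: "'a bop \<Rightarrow> 'a bop"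
  assumes \<phi>: "additive \<phi>" and "Q \<noteq> 1" and W: "Q * W = 0" and lc: "lie_centralizable_at \<phi> W"
  shows "\<exists>l. \<forall>A. \<phi> A - l *\<^sub>C A \<in> scalar_ops"
proof (rule lie_centralizer_eq_scaling_plus_scalar[OF \<phi> \<open>Q \<noteq> 1\<close>])
  fix A D assume A: "Q * A = 0" "A * Q = 0" and D: "Q * D = D"
  have AD: "A * D = 0" using A(2) D by (metis mult.assoc mult_zero_left)
  obtain c S where c: "c \<noteq> 0" "(A + c *\<^sub>C 1) * S = 1"
    using ex_right_inverse_large_scalar .
  have "lie_central_pair \<phi> (A + c *\<^sub>C (1 - Q)) D"
  proof (rule lie_central_pair_if_zero_product[OF \<phi> lc])
    have "A + c *\<^sub>C (1 - Q) = (1 - Q) * (A + c *\<^sub>C 1)"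
      by (simp add: algebra_simps A scaleC_mult_bop)
    then have "(A + c *\<^sub>C (1 - Q)) * (S * W) = (1 - Q) * ((A + c *\<^sub>C 1) * S) * W"
      by (simp only: mult.assoc)
    then show "(A + c *\<^sub>C (1 - Q)) * (S * W) = W" by (simp only: c(2)) (simp add: left_diff_distrib W)
    show "(A + c *\<^sub>C (1 - Q)) * D = 0" by (simp add: algebra_simps scaleC_mult_bop AD D)
  qed
  moreover have "lie_central_pair \<phi> (c *\<^sub>C (1 - Q)) D"
  proof (rule lie_central_pair_if_zero_product[OF \<phi> lc])
    show "c *\<^sub>C (1 - Q) * (inverse c *\<^sub>C W) = W"
      using c(1) by (simp add: scaleC_mult_bop algebra_simps W)
    show "c *\<^sub>C (1 - Q) * D = 0" by (simp add: algebra_simps scaleC_mult_bop D)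
  qed
  ultimately show "lie_central_pair \<phi> A D"
    using lie_central_pair_diff[OF \<phi>] by fastforce
next
  fix N G assume N: "Q * N = 0" "N * Q = N" and G: "Q * G = G" "G * Q = 0"
  have NW: "N * W = 0" using N(2) W by (metis mult.assoc mult_zero_right)
  show "lie_central_pair \<phi> (1 - Q - N) (G + N * G)"
  proof (rule lie_central_pair_if_zero_product[OF \<phi> lc])
    show "(1 - Q - N) * W = W" by (simp add: algebra_simps W NW)
    show "(1 - Q - N) * (G + N * G) = 0" using N G(1) by (rule sheared_product_eq_0)
  qed
qed

end

section \<open>Rank one idempotents and the characterization\<close>

text \<open>The two faithfulness conditions only need \<open>B\<close> of rank one: \<open>B = x \<otimes> g\<close> with \<open>g (V v) = 1\<close>
  detects a nonzero value \<open>V v\<close> from the left, and \<open>B = y \<otimes> f\<close> produces \<open>V y\<close> from the right.\<close>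

lemma minimal_idempotent_rank_one:
  fixes x :: "'a::complex_banach"
  assumes f: "bounded_functional f" and x: "f x = 1"
  shows "minimal_idempotent (rank_one x f)"
proof
  note [simp] = bop_apply_simps bop_apply_rank_one[OF f] bop_apply_scaleC x
    bounded_functionalD[OF f] scaleC_scaleC
  show "rank_one x f * rank_one x f = rank_one x f" by (rule bop_eqI) (simp add: scaleC_one)
  show "\<exists>c. rank_one x f * A * rank_one x f = c *\<^sub>C rank_one x f" for A
    by (intro exI[of _ "f (bop_apply A x)"] bop_eqI) (simp add: mult.commute)
  have x_neq_0: "x \<noteq> 0" by (metis x bounded_functionalD(3)[OF f] zero_neq_one)
  show "V = 0" if "\<And>B. rank_one x f * B * V = 0" for V
  proof (rule bop_eqI, rule ccontr)
    fix v assume "bop_apply V v \<noteq> bop_apply 0 v"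
    then obtain g where g: "bounded_functional g" "g (bop_apply V v) = 1"
      using ex_functional_eq_1 by auto
    show False
      using arg_cong[OF that[of "rank_one x g"], of "\<lambda>T. bop_apply T v"] g x_neq_0
      by (simp add: bop_apply_rank_one scaleC_one)
  qed
  show "V = 0" if "\<And>B. V * B * rank_one x f = 0" for V
  proof (rule bop_eqI)
    fix y
    show "bop_apply V y = bop_apply 0 y"
      using arg_cong[OF that[of "rank_one y f"], of "\<lambda>T. bop_apply T x"]
      by (simp add: scaleC_one)
  qed
qed

lemma ex_minimal_idempotent_annihilating:
  fixes W :: "'a::complex_banach bop"
  assumes "closure (range (bop_apply W)) \<noteq> UNIV"
  obtains Q where "minimal_idempotent Q" "Q * W = 0"
proof -
  obtain x where x: "x \<notin> closure (range (bop_apply W))" using assms by blast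
  have "subspace (range (bop_apply W))"
    by (intro linear_subspace_image linear_bop_apply subspace_UNIV)
  moreover have "c *\<^sub>C y \<in> range (bop_apply W)" if "y \<in> range (bop_apply W)" for c y
    using that by (auto simp flip: bop_apply_scaleC)
  ultimately obtain f where f: "bounded_functional f" "\<And>y. f (bop_apply W y) = 0" "f x = 1"
    using hahn_banach_separation[OF _ _ x] by (metis rangeI)
  have "rank_one x f * W = 0"
    by (rule bop_eqI) (simp add: bop_apply_simps bop_apply_rank_one f)
  then show ?thesis using that minimal_idempotent_rank_one f by blast
qed

theorem theorem1p1:
  fixes W :: "'a::complex_banach bop" and \<phi> :: "'a bop \<Rightarrow> 'a bop"
  assumes "closure (range (bop_apply W)) \<noteq> UNIV"
    and "additive \<phi>"
  shows "lie_centralizable_at \<phi> W \<longleftrightarrow>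
    (\<exists>(l::complex) (\<mu>::'a bop \<Rightarrow> 'a bop).
       additive \<mu> \<and> range \<mu> \<subseteq> scalar_ops \<and>
       (\<forall>A B. A * B = W \<longrightarrow> \<mu> (lie_product A B) = 0) \<and>
       (\<forall>A. \<phi> A = l *\<^sub>C A + \<mu> A))"
proof
  assume lc: "lie_centralizable_at \<phi> W"
  interpret additive \<phi> by fact
  obtain Q where Q: "minimal_idempotent Q" "Q * W = 0"
    using ex_minimal_idempotent_annihilating[OF assms(1)] .
  interpret minimal_idempotent Q by fact
  obtain l where l: "\<And>A. \<phi> A - l *\<^sub>C A \<in> scalar_ops"
  proof (cases "Q = 1")
    case True
    have "B \<in> scalar_ops" for B :: "'a bop"
      using scalar_corner[of B] by (auto simp: True)
    then show ?thesis by (rule that)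
  next
    case False
    then show ?thesis using lie_centralizable_at_left_annihilated[OF assms(2) _ Q(2) lc] that by metis
  qed
  define \<mu> where "\<mu> A = \<phi> A - l *\<^sub>C A" for A
  have eq: "\<phi> A = l *\<^sub>C A + \<mu> A" for A by (simp add: \<mu>_def)
  have \<mu>_scalar: "\<mu> A \<in> scalar_ops" for A using l by (simp add: \<mu>_def)
  have "additive \<mu>" by unfold_locales (simp add: \<mu>_def add scaleC_add_right)
  moreover have "\<mu> (lie_product A B) = 0" if "A * B = W" for A B
  proof -
    have "\<phi> (lie_product A B) = lie_product (\<phi> A) B"
      using lc that by (simp add: lie_centralizable_at_def)
    also have "\<dots> = l *\<^sub>C lie_product A B"
      unfolding eq[of A] by (simp add: lie_product_add_scalar \<mu>_scalar lie_product_scaleC)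
    finally show ?thesis by (simp add: \<mu>_def)
  qed
  ultimately show "\<exists>l \<mu>. additive \<mu> \<and> range \<mu> \<subseteq> scalar_ops \<and>
      (\<forall>A B. A * B = W \<longrightarrow> \<mu> (lie_product A B) = 0) \<and> (\<forall>A. \<phi> A = l *\<^sub>C A + \<mu> A)"
    using \<mu>_scalar eq by blast
next
  assume "\<exists>l \<mu>. additive \<mu> \<and> range \<mu> \<subseteq> scalar_ops \<and>
      (\<forall>A B. A * B = W \<longrightarrow> \<mu> (lie_product A B) = 0) \<and> (\<forall>A. \<phi> A = l *\<^sub>C A + \<mu> A)"
  then obtain l \<mu> where \<mu>: "range \<mu> \<subseteq> scalar_ops" "\<And>A B. A * B = W \<Longrightarrow> \<mu> (lie_product A B) = 0"
    "\<And>A. \<phi> A = l *\<^sub>C A + \<mu> A" by blast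
  then have "\<mu> A \<in> scalar_ops" for A by blast
  with \<mu>(2) show "lie_centralizable_at \<phi> W"
    by (simp add: lie_centralizable_at_def \<mu>(3) lie_product_add_scalar lie_product_scaleC)
qed

end
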